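(* Let $G$ be a finite group. Then $$\mathrm{Pr}(G,\mathrm{Aut}(G)) \geq \frac{1}{|S(G,\mathrm{Aut}(G))|}\left(1+\frac{|S(G,\mathrm{Aut}(G))|-1}{|G:L(G)|}\right),$$ and equality holds if and only if $\mathrm{orb}(x) = xS(G,\mathrm{Aut}(G))$ for all $x\in G\setminus L(G)$.
   Context: For a finite group $G$ with automorphism group $\mathrm{Aut}(G)$, $x\in G$ and $\alpha\in\mathrm{Aut}(G)$, write $[x,\alpha] := x^{-1}\alpha(x)$. Let $S(G,\mathrm{Aut}(G)) := \{[x,\alpha] : x\in G,\ \alpha\in\mathrm{Aut}(G)\}$ (a subset of $G$), $L(G) := \{x\in G : [x,\alpha]=1 \text{ for all } \alpha\in\mathrm{Aut}(G)\}$ (a subgroup of $G$), $\mathrm{orb}(x) := \{\alpha(x) : \alpha\in\mathrm{Aut}(G)\}$, and $xS(G,\mathrm{Aut}(G)) := \{xs : s\in S(G,\mathrm{Aut}(G))\}$. Also $$\mathrm{Pr}(G,\mathrm{Aut}(G)) := \frac{|\{(x,\alpha)\in G\times \mathrm{Aut}(G) : [x,\alpha]=1\}|}{|G||\mathrm{Aut}(G)|}.$$ *)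

theory Defs
  imports Complex_Main "HOL-Algebra.Bij" "HOL-Algebra.Coset" "HOL-Algebra.Group_Action"
begin

(* AutoGroup G consists of automorphisms that are extensional, i.e. fixed to be undefined outside
   carrier G, so its elements correspond one-to-one to the automorphisms of the group G; in
   particular it is finite when carrier G is. *)

lemma carrier_AutoGroup: "carrier (AutoGroup G) = auto G"
  by (simp add: AutoGroup_def)

definition aut_comm :: "('a, 'b) monoid_scheme \<Rightarrow> 'a \<Rightarrow> ('a \<Rightarrow> 'a) \<Rightarrow> 'a"
  where "aut_comm G x \<alpha> = inv\<^bsub>G\<^esub> x \<otimes>\<^bsub>G\<^esub> \<alpha> x"

definition aut_comm_set :: "('a, 'b) monoid_scheme \<Rightarrow> 'a set"
  where "aut_comm_set G = {aut_comm G x \<alpha> | x \<alpha>. x \<in> carrier G \<and> \<alpha> \<in> carrier (AutoGroup G)}"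

definition abs_center :: "('a, 'b) monoid_scheme \<Rightarrow> 'a set"
  where "abs_center G =
    {x \<in> carrier G. \<forall>\<alpha> \<in> carrier (AutoGroup G). aut_comm G x \<alpha> = \<one>\<^bsub>G\<^esub>}"

definition aut_orb :: "('a, 'b) monoid_scheme \<Rightarrow> 'a \<Rightarrow> 'a set"
  where "aut_orb G x = orbit (AutoGroup G) (\<lambda>\<alpha>. \<alpha>) x"

definition aut_comm_prob :: "('a, 'b) monoid_scheme \<Rightarrow> real"
  where "aut_comm_prob G =
    real (card {(x, \<alpha>) \<in> carrier G \<times> carrier (AutoGroup G). aut_comm G x \<alpha> = \<one>\<^bsub>G\<^esub>})
      / (real (order G) * real (order (AutoGroup G)))"

context group
begin

lemma aut_comm_eq_one_iff:
  assumes "x \<in> carrier G" "\<alpha> \<in> carrier (AutoGroup G)"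
  shows "aut_comm G x \<alpha> = \<one> \<longleftrightarrow> \<alpha> x = x"
proof -
  have "\<alpha> x \<in> carrier G"
    using assms by (auto simp: carrier_AutoGroup auto_def hom_def)
  then show ?thesis
    using assms(1) by (metis aut_comm_def inv_closed inv_equality inv_inv l_inv)
qed

lemma subgroup_abs_center: "subgroup (abs_center G) G"
proof -
  have L: "abs_center G = {x \<in> carrier G. \<forall>\<alpha> \<in> carrier (AutoGroup G). \<alpha> x = x}"
    using aut_comm_eq_one_iff by (auto simp: abs_center_def)
  have hom: "group_hom G G \<alpha>" if "\<alpha> \<in> carrier (AutoGroup G)" for \<alpha>
    using that by (simp add: carrier_AutoGroup auto_def group_hom_def group_hom_axioms_def is_group)
  show ?thesis
    unfolding L
    by (rule subgroupI)
      (auto simp: group_hom.hom_one[OF hom] group_hom.hom_inv[OF hom] group_hom.hom_mult[OF hom]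
        intro!: arg_cong2[where f = "(\<otimes>)"])
qed

end

end

theory Submission
  imports Defs
begin

text \<open>
  Write \<open>S\<close> for the set of autocommutators and \<open>L\<close> for the absolute centre. Counting the fixed
  pairs \<open>(x, \<alpha>)\<close> one \<open>x\<close> at a time, and using the orbit-stabilizer theorem for the action of the
  automorphism group on \<open>G\<close>, expresses the probability as the average of \<open>1 / |orb x|\<close> over \<open>G\<close>
  (\<open>aut_comm_prob_eq_orbit_average\<close>).

  An element of \<open>L\<close> contributes exactly \<open>1\<close>. For every \<open>x\<close>, the identity \<open>\<alpha> x = x [x, \<alpha>]\<close> puts the
  orbit inside the translate \<open>x S\<close>, which has \<open>|S|\<close> elements, so each \<open>x\<close> outside \<open>L\<close> contributes
  at least \<open>1 / |S|\<close>. By Lagrange's theorem for \<open>L\<close>, replacing all of these contributions by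
  \<open>1 / |S|\<close> gives precisely the claimed lower bound. The sum loses nothing exactly when no term
  loses anything, that is, when \<open>|orb x| = |x S|\<close> for all \<open>x\<close> outside \<open>L\<close>; for an inclusion of
  finite sets this means \<open>orb x = x S\<close>.
\<close>

lemma (in group) AutoGroup_action: "group_action (AutoGroup G) (carrier G) (\<lambda>\<alpha>. \<alpha>)"
proof -
  have "(\<lambda>\<alpha>. \<alpha>) \<in> hom (AutoGroup G) (BijGroup (carrier G))"
    by (auto simp: hom_def AutoGroup_def BijGroup_def auto_def)
  then show ?thesis
    by (simp add: group_action_def group_hom_def group_hom_axioms_def AutoGroup group_BijGroup)
qed

lemma (in group) AutoGroup_closed:
  assumes "x \<in> carrier G" "\<alpha> \<in> carrier (AutoGroup G)"
  shows "\<alpha> x \<in> carrier G"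
  using assms by (auto simp: carrier_AutoGroup auto_def hom_def)

lemma (in group) finite_AutoGroup:
  assumes "finite (carrier G)"
  shows "finite (carrier (AutoGroup G))"
proof (rule finite_subset)
  show "carrier (AutoGroup G) \<subseteq> carrier G \<rightarrow>\<^sub>E carrier G"
    by (auto simp: carrier_AutoGroup auto_def Bij_def hom_def PiE_def)
  show "finite (carrier G \<rightarrow>\<^sub>E carrier G)"
    using assms by (simp add: finite_PiE)
qed

lemma (in group) mem_aut_orb_self: "x \<in> carrier G \<Longrightarrow> x \<in> aut_orb G x"
  unfolding aut_orb_def by (rule group_action.orbit_refl[OF AutoGroup_action])

lemma (in group) aut_orb_subset_carrier: "x \<in> carrier G \<Longrightarrow> aut_orb G x \<subseteq> carrier G"
  by (auto simp: aut_orb_def orbit_def AutoGroup_closed)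

lemma (in group) card_aut_orb_pos:
  assumes "finite (carrier G)" "x \<in> carrier G"
  shows "0 < card (aut_orb G x)"
  using mem_aut_orb_self[OF assms(2)] finite_subset[OF aut_orb_subset_carrier[OF assms(2)] assms(1)]
  by (auto simp: card_gt_0_iff)

lemma (in group) aut_orb_abs_center:
  assumes "x \<in> abs_center G"
  shows "aut_orb G x = {x}"
proof -
  have "x \<in> carrier G"
    using assms by (simp add: abs_center_def)
  moreover have "\<alpha> x = x" if "\<alpha> \<in> carrier (AutoGroup G)" for \<alpha>
    using assms that aut_comm_eq_one_iff by (auto simp: abs_center_def)
  ultimately show ?thesis
    using mem_aut_orb_self[of x] by (auto simp: aut_orb_def orbit_def)
qed

lemma (in group) aut_comm_set_subset_carrier: "aut_comm_set G \<subseteq> carrier G"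
  by (auto simp: aut_comm_set_def aut_comm_def AutoGroup_closed)

text \<open>The commutator is set up so that \<open>\<alpha> x = x [x, \<alpha>]\<close>.\<close>

lemma (in group) aut_orb_subset_l_coset:
  assumes x: "x \<in> carrier G"
  shows "aut_orb G x \<subseteq> x <# aut_comm_set G"
proof
  fix y assume "y \<in> aut_orb G x"
  then obtain \<alpha> where \<alpha>: "\<alpha> \<in> carrier (AutoGroup G)" "y = \<alpha> x"
    by (auto simp: aut_orb_def orbit_def)
  then have "y = x \<otimes> aut_comm G x \<alpha>"
    using x AutoGroup_closed[OF x] by (simp add: aut_comm_def m_assoc[symmetric])
  moreover have "aut_comm G x \<alpha> \<in> aut_comm_set G"
    using x \<alpha> by (auto simp: aut_comm_set_def)
  ultimately show "y \<in> x <# aut_comm_set G"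
    by (auto simp: l_coset_def)
qed

lemma (in group) card_l_coset:
  assumes "x \<in> carrier G" "A \<subseteq> carrier G"
  shows "card (x <# A) = card A"
proof -
  have "x <# A = (\<lambda>a. x \<otimes> a) ` A"
    by (auto simp: l_coset_def)
  then show ?thesis
    using inj_on_subset[OF inj_on_cmult[OF assms(1)] assms(2)] by (simp add: card_image)
qed

lemma (in group) card_aut_orb_le:
  assumes "finite (carrier G)" "x \<in> carrier G"
  shows "card (aut_orb G x) \<le> card (aut_comm_set G)"
    and "card (aut_orb G x) = card (aut_comm_set G) \<longleftrightarrow> aut_orb G x = x <# aut_comm_set G"
proof -
  have card: "card (x <# aut_comm_set G) = card (aut_comm_set G)"
    using assms(2) aut_comm_set_subset_carrier by (rule card_l_coset)
  have fin: "finite (x <# aut_comm_set G)"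
    using l_coset_subset_G[OF aut_comm_set_subset_carrier assms(2)] assms(1)
    by (rule finite_subset)
  show "card (aut_orb G x) \<le> card (aut_comm_set G)"
    using card_mono[OF fin aut_orb_subset_l_coset[OF assms(2)]] card by simp
  show "card (aut_orb G x) = card (aut_comm_set G) \<longleftrightarrow> aut_orb G x = x <# aut_comm_set G"
    using card_subset_eq[OF fin aut_orb_subset_l_coset[OF assms(2)]] card by auto
qed

text \<open>
  A pair \<open>(x, \<alpha>)\<close> counts exactly when \<open>\<alpha>\<close> stabilizes \<open>x\<close>, and the proportion of automorphisms in the
  stabilizer of \<open>x\<close> is \<open>1 / |orb x|\<close>.
\<close>

lemma (in group) aut_comm_prob_eq_orbit_average:
  assumes fin: "finite (carrier G)"
  shows "aut_comm_prob G = (\<Sum>x\<in>carrier G. 1 / real (card (aut_orb G x))) / real (order G)"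
proof -
  let ?A = "AutoGroup G" and ?Stab = "stabilizer (AutoGroup G) (\<lambda>\<alpha>. \<alpha>)"
  have finA: "finite (carrier ?A)"
    using fin by (rule finite_AutoGroup)
  have ordA: "order ?A > 0"
    using finA monoid.order_gt_0_iff_finite[OF group.is_monoid[OF AutoGroup]] by simp
  have stab: "real (card (?Stab x)) = real (order ?A) * (1 / real (card (aut_orb G x)))"
    if x: "x \<in> carrier G" for x
  proof -
    have "card (aut_orb G x) * card (?Stab x) = order ?A"
      unfolding aut_orb_def
      using group_action.orbit_stabilizer_theorem[OF AutoGroup_action x] .
    then show ?thesis
      using card_aut_orb_pos[OF fin x] by (auto simp flip: of_nat_mult simp: field_simps)
  qed
  have "{(x, \<alpha>) \<in> carrier G \<times> carrier ?A. aut_comm G x \<alpha> = \<one>} = (SIGMA x:carrier G. ?Stab x)"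
    using aut_comm_eq_one_iff by (auto simp: stabilizer_def)
  moreover have "finite (?Stab x)" for x
    using finA by (simp add: stabilizer_def)
  ultimately have "card {(x, \<alpha>) \<in> carrier G \<times> carrier ?A. aut_comm G x \<alpha> = \<one>}
      = (\<Sum>x\<in>carrier G. card (?Stab x))"
    using fin by (simp add: card_SigmaI)
  then have "real (card {(x, \<alpha>) \<in> carrier G \<times> carrier ?A. aut_comm G x \<alpha> = \<one>})
      = real (order ?A) * (\<Sum>x\<in>carrier G. 1 / real (card (aut_orb G x)))"
    by (simp add: stab sum_distrib_left)
  then show ?thesis
    using ordA by (simp add: aut_comm_prob_def)
qed

theorem theorem3p7:
  fixes G :: "('a, 'b) monoid_scheme"
  assumes "group G" and "finite (carrier G)"
  shows "aut_comm_prob G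
           \<ge> 1 / real (card (aut_comm_set G))
               * (1 + (real (card (aut_comm_set G)) - 1)
                        / real (card (rcosets\<^bsub>G\<^esub> (abs_center G))))
         \<and> (aut_comm_prob G
              = 1 / real (card (aut_comm_set G))
                  * (1 + (real (card (aut_comm_set G)) - 1)
                           / real (card (rcosets\<^bsub>G\<^esub> (abs_center G))))
            \<longleftrightarrow> (\<forall>x \<in> carrier G - abs_center G. aut_orb G x = x <#\<^bsub>G\<^esub> aut_comm_set G))"
proof -
  interpret group G by fact
  note fin = assms(2)
  let ?S = "aut_comm_set G" and ?L = "abs_center G" and ?f = "\<lambda>x. 1 / real (card (aut_orb G x))"
  let ?s = "real (card ?S)" and ?i = "real (card (rcosets\<^bsub>G\<^esub> ?L))"
  let ?bound = "1 / ?s * (1 + (?s - 1) / ?i)"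
  have sub: "?L \<subseteq> carrier G"
    by (auto simp: abs_center_def)
  have finD: "finite (carrier G - ?L)"
    using fin by simp
  have order: "real (order G) > 0"
    using fin order_gt_0_iff_finite by simp
  have s: "?s > 0"
    using card_aut_orb_pos[OF fin one_closed] card_aut_orb_le(1)[OF fin one_closed] by linarith
  have lagrangeL: "?i * real (card ?L) = real (order G)"
    using lagrange[OF subgroup_abs_center] by (simp flip: of_nat_mult)
  have i: "?i > 0"
    using lagrangeL order by (cases "?i = 0") auto
  have cardL: "real (card ?L) = real (order G) / ?i"
    using lagrangeL i by (simp add: field_simps)
  have cardD: "real (card (carrier G - ?L)) = real (order G) - real (card ?L)"
    using card_Diff_subset[OF finite_subset[OF sub fin] sub] card_mono[OF fin sub]
    by (simp add: order_def of_nat_diff)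

  have "sum ?f (carrier G) = sum ?f (carrier G - ?L) + sum ?f ?L"
    using fin sub by (rule sum.subset_diff[rotated])
  also have "sum ?f ?L = real (card ?L)"
    by (simp add: aut_orb_abs_center)
  finally have prob: "aut_comm_prob G = (sum ?f (carrier G - ?L) + real (card ?L)) / real (order G)"
    by (simp add: aut_comm_prob_eq_orbit_average[OF fin])
  \<comment> \<open>Substituting \<open>1 / |G:L| = |L| / |G|\<close> shows that the claimed bound is the same average with every
    term outside \<open>L\<close> replaced by \<open>1 / |S|\<close>.\<close>
  have bound: "?bound = ((\<Sum>x\<in>carrier G - ?L. 1 / ?s) + real (card ?L)) / real (order G)"
    using s i order by (simp add: cardD cardL field_simps)

  have le: "1 / ?s \<le> ?f x" if "x \<in> carrier G - ?L" for x
    using that card_aut_orb_pos[OF fin, of x] card_aut_orb_le(1)[OF fin, of x]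
    by (simp add: frac_le)
  have "?bound \<le> aut_comm_prob G"
    unfolding prob bound by (intro divide_right_mono add_right_mono sum_mono le) simp_all
  moreover have "aut_comm_prob G = ?bound \<longleftrightarrow>
      (\<Sum>x\<in>carrier G - ?L. 1 / ?s) = sum ?f (carrier G - ?L)"
    unfolding prob bound using order by auto
  moreover have "\<dots> \<longleftrightarrow> (\<forall>x \<in> carrier G - ?L. 1 / ?s = ?f x)"
    using sum_mono_inv[OF _ le _ finD, of "\<lambda>x. x"] by (metis (no_types, lifting) sum.cong)
  moreover have "\<dots> \<longleftrightarrow> (\<forall>x \<in> carrier G - ?L. aut_orb G x = x <#\<^bsub>G\<^esub> ?S)"
  proof (rule ball_cong[OF refl])
    fix x assume "x \<in> carrier G - ?L"
    then have "card (aut_orb G x) = card ?S \<longleftrightarrow> aut_orb G x = x <#\<^bsub>G\<^esub> ?S"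
      using card_aut_orb_le(2)[OF fin] by blast
    then show "1 / ?s = ?f x \<longleftrightarrow> aut_orb G x = x <#\<^bsub>G\<^esub> ?S"
      by auto
  qed
  ultimately show ?thesis
    by blast
qed

end
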